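(* For every integer $m\ge 1$ there exists an $(m,2^m-1,1)$-domination mapping that is a bijection from $\{0,1\}^m$ onto $\mathcal{B}(2^m-1,1)$. Consequently $\nu(m,1)=2^m-1$ for all $m\ge 1$, and $\mu(n,1)=\lfloor\log_2(n+1)\rfloor$ for all $n\ge 1$.
   Context: For $y \in \{0,1\}^n$, $\mathrm{wt}(y)$ is the number of nonzero coordinates, and $\mathcal{B}(n,w)=\{y\in\{0,1\}^n : \mathrm{wt}(y)\le w\}$. A domination graph is a bipartite graph $G=([m]\cup[n],E)$ with left vertex set $[m]$ and right vertex set $[n]$ having no isolated right vertices. An injective map $\varphi:\{0,1\}^m\to\mathcal{B}(n,w)$ is $G$-dominating if for every $x\in\{0,1\}^m$ and every edge $(i,j)\in E$: $x_i=0$ implies that the $j$-th coordinate of $\varphi(x)$ is $0$. An $(m,n,w)$-domination mapping is an injective map $\{0,1\}^m\to\mathcal{B}(n,w)$ that is $G$-dominating for some domination graph $G=([m]\cup[n],E)$. $\nu(m,w)$ is the minimum $n$ such that an $(m,n,w)$-domination mapping exists, and $\mu(n,w)$ is the maximum $m$ such that an $(m,n,w)$-domination mapping exists. *)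

theory Defs
  imports Complex_Main "HOL-Library.FuncSet"
begin

text \<open>Binary vectors of length \<open>n\<close> are functions on \<open>{1..n}\<close>. They are taken to be extensional,
  so that equality of functions is equality of vectors.\<close>

definition bin_vecs :: "nat \<Rightarrow> (nat \<Rightarrow> nat) set" where
  "bin_vecs n = {1..n} \<rightarrow>\<^sub>E {0, 1}"

definition wt :: "nat \<Rightarrow> (nat \<Rightarrow> nat) \<Rightarrow> nat" where
  "wt n y = card {j \<in> {1..n}. y j \<noteq> 0}"

definition hamming_ball :: "nat \<Rightarrow> nat \<Rightarrow> (nat \<Rightarrow> nat) set" where
  "hamming_ball n w = {y \<in> bin_vecs n. wt n y \<le> w}"

text \<open>An edge is a pair (left vertex, right vertex), which keeps the two sides apart although both
  are initial segments of the positive integers. Isolated left vertices are allowed.\<close>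

definition domination_graph :: "nat \<Rightarrow> nat \<Rightarrow> (nat \<times> nat) set \<Rightarrow> bool" where
  "domination_graph m n E \<longleftrightarrow>
     E \<subseteq> {1..m} \<times> {1..n} \<and> (\<forall>j\<in>{1..n}. \<exists>i\<in>{1..m}. (i, j) \<in> E)"

definition dominating ::
  "nat \<Rightarrow> (nat \<times> nat) set \<Rightarrow> ((nat \<Rightarrow> nat) \<Rightarrow> nat \<Rightarrow> nat) \<Rightarrow> bool" where
  "dominating m E \<phi> \<longleftrightarrow>
     (\<forall>x\<in>bin_vecs m. \<forall>(i, j)\<in>E. x i = 0 \<longrightarrow> \<phi> x j = 0)"

definition domination_mapping ::
  "nat \<Rightarrow> nat \<Rightarrow> nat \<Rightarrow> ((nat \<Rightarrow> nat) \<Rightarrow> nat \<Rightarrow> nat) \<Rightarrow> bool" where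
  "domination_mapping m n w \<phi> \<longleftrightarrow>
     \<phi> \<in> bin_vecs m \<rightarrow> hamming_ball n w \<and> inj_on \<phi> (bin_vecs m) \<and>
     (\<exists>E. domination_graph m n E \<and> dominating m E \<phi>)"

definition nu :: "nat \<Rightarrow> nat \<Rightarrow> nat" where
  "nu m w = (LEAST n. \<exists>\<phi>. domination_mapping m n w \<phi>)"

text \<open>The maximum is only meaningful if some \<open>m\<close> is admissible and the admissible ones are bounded.
  The lemmas below show that this holds for \<open>n \<ge> 1\<close> and \<open>w \<ge> 1\<close>.\<close>

definition mu :: "nat \<Rightarrow> nat \<Rightarrow> nat" where
  "mu n w = (GREATEST m. \<exists>\<phi>. domination_mapping m n w \<phi>)"

lemma finite_bin_vecs: "finite (bin_vecs n)"
  by (simp add: bin_vecs_def finite_PiE)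

lemma card_bin_vecs: "card (bin_vecs n) = 2 ^ n"
  by (simp add: bin_vecs_def card_PiE numeral_2_eq_2)

lemma domination_mapping_le:
  assumes "domination_mapping m n w \<phi>"
  shows "m \<le> n"
proof -
  have "\<phi> ` bin_vecs m \<subseteq> bin_vecs n" "inj_on \<phi> (bin_vecs m)"
    using assms by (auto simp: domination_mapping_def hamming_ball_def)
  then have "card (bin_vecs m) \<le> card (bin_vecs n)"
    using card_inj_on_le finite_bin_vecs by blast
  then show ?thesis
    by (simp add: card_bin_vecs)
qed

lemma ex_domination_mapping_one:
  assumes "n \<ge> 1" "w \<ge> 1"
  shows "\<exists>\<phi>. domination_mapping 1 n w \<phi>"
proof -
  define \<phi> where "\<phi> x = restrict (\<lambda>j. if j = 1 then x 1 else 0) {1..n}" for x :: "nat \<Rightarrow> nat"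
  have phi_one: "\<phi> x 1 = x 1" for x
    using assms by (simp add: \<phi>_def)
  have "\<phi> x \<in> hamming_ball n w" if "x \<in> bin_vecs 1" for x
  proof -
    have "x 1 \<in> {0, 1}"
      using that by (auto simp: bin_vecs_def)
    then have "\<phi> x \<in> bin_vecs n"
      by (auto simp: \<phi>_def bin_vecs_def)
    moreover have "wt n (\<phi> x) \<le> 1"
    proof -
      have supp: "{j \<in> {1..n}. \<phi> x j \<noteq> 0} \<subseteq> {1}"
        by (auto simp: \<phi>_def split: if_splits)
      show ?thesis
        using card_mono[OF _ supp] by (simp add: wt_def)
    qed
    ultimately show ?thesis
      using assms by (simp add: hamming_ball_def)
  qed
  moreover have "inj_on \<phi> (bin_vecs 1)"
  proof (rule inj_onI)
    fix x y assume xy: "x \<in> bin_vecs 1" "y \<in> bin_vecs 1" "\<phi> x = \<phi> y"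
    then have "x 1 = y 1"
      using phi_one by metis
    then show "x = y"
      using xy(1,2) unfolding bin_vecs_def by (elim PiE_ext) auto
  qed
  moreover have "domination_graph 1 n ({1} \<times> {1..n})"
    by (auto simp: domination_graph_def)
  moreover have "dominating 1 ({1} \<times> {1..n}) \<phi>"
    by (auto simp: dominating_def \<phi>_def)
  ultimately show ?thesis
    unfolding domination_mapping_def by blast
qed

lemma mu_attained:
  assumes "n \<ge> 1" "w \<ge> 1"
  shows "\<exists>\<phi>. domination_mapping (mu n w) n w \<phi>"
  unfolding mu_def
  by (rule GreatestI_nat[where P = "\<lambda>m. \<exists>\<phi>. domination_mapping m n w \<phi>",
        OF ex_domination_mapping_one[OF assms]])
    (blast intro: domination_mapping_le)

lemma mu_maximal: "domination_mapping m n w \<phi> \<Longrightarrow> m \<le> mu n w"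
  unfolding mu_def
  by (rule Greatest_le_nat[where P = "\<lambda>m. \<exists>\<phi>. domination_mapping m n w \<phi>", OF exI])
    (assumption, blast intro: domination_mapping_le)

end

theory Submission
  imports Defs
begin

text \<open>The Hamming ball of radius one in dimension \<open>n\<close> consists of the zero vector and the \<open>n\<close> unit
  vectors, so injectivity alone forces \<open>2 ^ m \<le> n + 1\<close>. Conversely, send the zero vector to zero and
  the nonzero vectors to distinct unit vectors. Every right vertex \<open>j\<close> is then hit by at most one
  nonzero \<open>x\<close>, and joining \<open>j\<close> to some \<open>i\<close> in the support of this \<open>x\<close> gives a domination graph.\<close>

text \<open>The index \<open>0\<close> lies outside \<open>{1..n}\<close>, so \<open>unit_vec n 0\<close> is the zero vector.\<close>

definition unit_vec :: "nat \<Rightarrow> nat \<Rightarrow> nat \<Rightarrow> nat" where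
  "unit_vec n j = (\<lambda>i\<in>{1..n}. if i = j then 1 else 0)"

lemma unit_vec_in_bin_vecs: "unit_vec n j \<in> bin_vecs n"
  by (auto simp: unit_vec_def bin_vecs_def)

lemma inj_on_unit_vec: "inj_on (unit_vec n) {0..n}"
proof (rule inj_onI, rule ccontr)
  fix i j assume ij: "i \<in> {0..n}" "j \<in> {0..n}" "unit_vec n i = unit_vec n j" "i \<noteq> j"
  \<comment> \<open>Both coordinates are compared because one index may be 0, which lies outside
    \<open>{1..n}\<close>; the other is then positive and separates the two vectors.\<close>
  have "unit_vec n i i = unit_vec n j i" "unit_vec n i j = unit_vec n j j"
    using ij(3) by simp_all
  then show False
    using ij by (auto simp: unit_vec_def split: if_splits)
qed

lemma hamming_ball_one: "hamming_ball n 1 = unit_vec n ` {0..n}"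
proof (intro equalityI subsetI)
  fix y assume "y \<in> hamming_ball n 1"
  then have y: "y \<in> {1..n} \<rightarrow>\<^sub>E {0, 1}" and le: "card {j \<in> {1..n}. y j \<noteq> 0} \<le> 1"
    by (auto simp: hamming_ball_def bin_vecs_def wt_def)
  \<comment> \<open>The choice \<open>k = 0\<close> stands for empty support. For
    \<open>k > 0\<close> the last conjunct excludes the zero vector, so \<open>k\<close> determines
    \<open>y\<close>.\<close>
  have "\<exists>k\<in>{0..n}. {j \<in> {1..n}. y j \<noteq> 0} \<subseteq> {k} \<and> (k > 0 \<longrightarrow> y k \<noteq> 0)"
  proof (cases "{j \<in> {1..n}. y j \<noteq> 0} = {}")
    case True
    then show ?thesis by (intro bexI[of _ 0]) auto
  next
    case False
    then obtain k where k: "k \<in> {j \<in> {1..n}. y j \<noteq> 0}"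
      by blast
    with le have "{j \<in> {1..n}. y j \<noteq> 0} \<subseteq> {k}"
      by (auto simp: card_le_Suc0_iff_eq)
    with k show ?thesis by (intro bexI[of _ k]) auto
  qed
  then obtain k where k: "k \<le> n" "{j \<in> {1..n}. y j \<noteq> 0} \<subseteq> {k}" "k > 0 \<longrightarrow> y k \<noteq> 0"
    by auto
  have "y = unit_vec n k"
  proof (rule PiE_ext[OF y unit_vec_in_bin_vecs[unfolded bin_vecs_def]])
    fix i assume i: "i \<in> {1..n}"
    with y have "y i \<in> {0, 1}" by (rule PiE_mem)
    with i k show "y i = unit_vec n k i"
      by (auto simp: unit_vec_def)
  qed
  with k(1) show "y \<in> unit_vec n ` {0..n}" by simp
next
  fix y assume "y \<in> unit_vec n ` {0..n}"
  then obtain k where y: "y = unit_vec n k" by blast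
  have "{j \<in> {1..n}. y j \<noteq> 0} \<subseteq> {k}"
    by (auto simp: y unit_vec_def split: if_splits)
  from card_mono[OF _ this] show "y \<in> hamming_ball n 1"
    by (simp add: hamming_ball_def wt_def y unit_vec_in_bin_vecs)
qed

lemma card_hamming_ball_one: "card (hamming_ball n 1) = n + 1"
  by (simp only: hamming_ball_one card_image[OF inj_on_unit_vec]) simp

lemma domination_mapping_one_card:
  assumes "domination_mapping m n 1 \<phi>"
  shows "2 ^ m \<le> n + 1"
proof -
  have "\<phi> ` bin_vecs m \<subseteq> hamming_ball n 1" "inj_on \<phi> (bin_vecs m)"
    using assms by (auto simp: domination_mapping_def)
  moreover have "finite (hamming_ball n 1)"
    by (simp only: hamming_ball_one) simp
  ultimately have "card (bin_vecs m) \<le> card (hamming_ball n 1)"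
    by (intro card_inj_on_le)
  then show ?thesis
    by (simp only: card_bin_vecs card_hamming_ball_one)
qed

lemma nonzero_vec_support:
  assumes "x \<in> bin_vecs m" "x \<noteq> unit_vec m 0"
  shows "\<exists>i\<in>{1..m}. x i \<noteq> 0"
proof (rule ccontr)
  assume "\<not> ?thesis"
  with assms(1) have "x = unit_vec m 0"
    unfolding bin_vecs_def
    by (intro PiE_ext[OF _ unit_vec_in_bin_vecs[unfolded bin_vecs_def]]) (auto simp: unit_vec_def)
  with assms(2) show False by simp
qed

text \<open>Allowing every \<open>n\<close> with \<open>2 ^ m \<le> n + 1\<close>, not just
  equality, serves both the value of \<open>nu\<close> and the upper estimate for
  \<open>mu\<close>.\<close>

lemma ex_domination_mapping_weight_one:
  assumes "m \<ge> 1" "2 ^ m \<le> n + 1"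
  shows "\<exists>\<phi>. domination_mapping m n 1 \<phi>"
proof -
  define z where "z = unit_vec m 0"
  have z: "z \<in> bin_vecs m"
    by (simp add: z_def unit_vec_in_bin_vecs)
  have "card (bin_vecs m - {z}) \<le> card {1..n}"
    using assms z by (simp add: card_bin_vecs)
  then obtain f where f: "f ` (bin_vecs m - {z}) \<subseteq> {1..n}" "inj_on f (bin_vecs m - {z})"
    using card_le_inj[of "bin_vecs m - {z}" "{1..n}"] finite_bin_vecs by auto
  \<comment> \<open>\<open>b\<close> indexes the image vector: index 0 sends \<open>z\<close> to the
    zero vector, and it cannot clash with \<open>f\<close>, whose values there are at least
    1.\<close>
  define b where "b x = (if x = z then 0 else f x)" for x
  have b_le: "b x \<le> n" if "x \<in> bin_vecs m" for x
    using f(1) that by (auto simp: b_def)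
  have b_inj: "inj_on b (bin_vecs m)"
  proof (rule inj_onI)
    fix x y assume xy: "x \<in> bin_vecs m" "y \<in> bin_vecs m" "b x = b y"
    show "x = y"
    proof (cases "x = z \<or> y = z")
      case True
      have "f u \<ge> 1" if "u \<in> bin_vecs m" "u \<noteq> z" for u
        using f(1) that by auto
      with True xy show ?thesis
        by (force simp: b_def split: if_splits)
    next
      case False
      with xy f(2) show ?thesis
        by (auto simp: b_def inj_on_def)
    qed
  qed
  define \<phi> where "\<phi> x = unit_vec n (b x)" for x
  \<comment> \<open>The largest edge set for which \<open>\<phi>\<close> is dominating, so only the
    absence of isolated right vertices remains to be shown.\<close>
  define E where "E = {(i, j) \<in> {1..m} \<times> {1..n}. \<forall>x\<in>bin_vecs m. x i = 0 \<longrightarrow> \<phi> x j = 0}"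
  have \<phi>_nz: "b x = j" if "\<phi> x j \<noteq> 0" "j \<in> {1..n}" for x j
    using that by (auto simp: \<phi>_def unit_vec_def split: if_splits)
  have "\<exists>i\<in>{1..m}. (i, j) \<in> E" if j: "j \<in> {1..n}" for j
  proof (cases "\<exists>x\<in>bin_vecs m. b x = j")
    case True
    then obtain x where x: "x \<in> bin_vecs m" "b x = j" by blast
    with j have "x \<noteq> z" by (auto simp: b_def)
    with x obtain i where i: "i \<in> {1..m}" "x i \<noteq> 0"
      using nonzero_vec_support unfolding z_def by blast
    \<comment> \<open>By injectivity of \<open>b\<close>, only \<open>x\<close> has an image that is
      nonzero at \<open>j\<close>, and \<open>x i\<close> is nonzero.\<close>
    have "\<phi> y j = 0" if y: "y \<in> bin_vecs m" "y i = 0" for y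
    proof (rule ccontr)
      assume "\<phi> y j \<noteq> 0"
      then have "b y = j" using j by (rule \<phi>_nz)
      with x y(1) b_inj have "y = x" by (auto simp: inj_on_def)
      with i y(2) show False by simp
    qed
    with i j show ?thesis by (auto simp: E_def intro!: bexI[of _ i])
  next
    case False
    \<comment> \<open>Coordinate \<open>j\<close> vanishes on all images, so any left vertex is a
      neighbour; vertex 1 exists since \<open>m \<ge> 1\<close>.\<close>
    with \<phi>_nz j assms(1) show ?thesis
      by (intro bexI[of _ 1]) (auto simp: E_def)
  qed
  then have "domination_graph m n E"
    by (auto simp: domination_graph_def E_def)
  moreover have "dominating m E \<phi>"
    by (auto simp: dominating_def E_def)
  moreover have "\<phi> \<in> bin_vecs m \<rightarrow> hamming_ball n 1"
    unfolding hamming_ball_one using b_le by (auto simp: \<phi>_def)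
  moreover have "inj_on \<phi> (bin_vecs m)"
    using b_inj b_le inj_on_unit_vec[of n] by (auto simp: \<phi>_def inj_on_def)
  ultimately show ?thesis
    unfolding domination_mapping_def by blast
qed

text \<open>Cube and ball both have \<open>2 ^ m\<close> elements, so injectivity forces
  surjectivity.\<close>

lemma bij_betw_domination_mapping_one:
  assumes "domination_mapping m (2 ^ m - 1) 1 \<phi>"
  shows "bij_betw \<phi> (bin_vecs m) (hamming_ball (2 ^ m - 1) 1)"
proof -
  have *: "\<phi> ` bin_vecs m \<subseteq> hamming_ball (2 ^ m - 1) 1" "inj_on \<phi> (bin_vecs m)"
    using assms by (auto simp: domination_mapping_def)
  moreover have "card (\<phi> ` bin_vecs m) = card (hamming_ball (2 ^ m - 1) 1)"
    unfolding card_image[OF *(2)] card_bin_vecs card_hamming_ball_one by simp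
  moreover have "finite (hamming_ball (2 ^ m - 1) 1)"
    by (simp only: hamming_ball_one) simp
  ultimately show ?thesis
    by (simp add: bij_betw_def card_subset_eq)
qed

lemma nu_one:
  assumes "m \<ge> 1"
  shows "nu m 1 = 2 ^ m - 1"
  unfolding nu_def
proof (rule Least_equality)
  show "\<exists>\<phi>. domination_mapping m (2 ^ m - 1) 1 \<phi>"
    using assms by (intro ex_domination_mapping_weight_one) simp_all
next
  fix n assume "\<exists>\<phi>. domination_mapping m n 1 \<phi>"
  then show "2 ^ m - 1 \<le> n"
    using domination_mapping_one_card by fastforce
qed

text \<open>Counting and construction together make \<open>mu n 1\<close> the largest exponent
  \<open>m\<close> with \<open>2 ^ m \<le> n + 1\<close>, which is the floor of the
  logarithm.\<close>

lemma mu_one: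
  assumes "n \<ge> 1"
  shows "int (mu n 1) = \<lfloor>log 2 (real n + 1)\<rfloor>"
proof -
  have lower: "2 ^ mu n 1 \<le> n + 1"
    using mu_attained[OF assms order_refl] domination_mapping_one_card by blast
  \<comment> \<open>Otherwise the construction would apply to \<open>mu n 1 + 1\<close>, against
    maximality.\<close>
  have upper: "n + 1 < 2 ^ (mu n 1 + 1)"
  proof (rule ccontr)
    assume "\<not> ?thesis"
    then obtain \<phi> where "domination_mapping (mu n 1 + 1) n 1 \<phi>"
      using ex_domination_mapping_weight_one[of "mu n 1 + 1" n] by auto
    from mu_maximal[OF this] show False by simp
  qed
  show ?thesis
    using floor_log_nat_eq_if[OF lower upper] by (simp add: add.commute)
qed

theorem theorem13:
  shows "(\<forall>m::nat. m \<ge> 1 \<longrightarrow>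
            (\<exists>\<phi>. domination_mapping m (2 ^ m - 1) 1 \<phi> \<and>
                 bij_betw \<phi> (bin_vecs m) (hamming_ball (2 ^ m - 1) 1))) \<and>
         (\<forall>m::nat. m \<ge> 1 \<longrightarrow> nu m 1 = 2 ^ m - 1) \<and>
         (\<forall>n::nat. n \<ge> 1 \<longrightarrow> int (mu n 1) = \<lfloor>log 2 (real n + 1)\<rfloor>)"
proof (intro conjI allI impI)
  fix m :: nat assume "m \<ge> 1"
  then obtain \<phi> where "domination_mapping m (2 ^ m - 1) 1 \<phi>"
    using ex_domination_mapping_weight_one[of m "2 ^ m - 1"] by auto
  with bij_betw_domination_mapping_one
  show "\<exists>\<phi>. domination_mapping m (2 ^ m - 1) 1 \<phi> \<and>
      bij_betw \<phi> (bin_vecs m) (hamming_ball (2 ^ m - 1) 1)"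
    by blast
qed (rule nu_one mu_one; assumption)+

end
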